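(* Let $P$ and $Q$ be (nonempty) posets with $$F_P(m)=\sum_{i=1}^{|P|}a_i\binom{m+i-1}{i},\qquad F_Q(m)=\sum_{j=1}^{|Q|}b_j\binom{m+j-1}{j}.$$ Then $$F_{P\oplus Q}(m)=\sum_{k=1}^{|P|+|Q|}\left(\sum_{i=1}^{k}a_i b_{k-i}\right)\binom{m+k-1}{k},$$ where $a_i=0$ for $i>|P|$, and $b_j=0$ for $j=0$ or $j>|Q|$. That is, the coefficients of $F_{P\oplus Q}$ in the chain basis are the Cauchy product of those of $F_P$ and $F_Q$.
   Context: All posets are finite. $F_P(m)$ is the number of order-preserving maps $f:P\to\{1,\dots,m\}$ (i.e. $f(a)\le f(b)$ whenever $a\le b$); it is a polynomial in $m$. The chain basis of the polynomials in $m$ is $\binom{m+k-1}{k}$, $k\ge0$. The ordinal sum $P\oplus Q$ is the poset on the disjoint union of $P$ and $Q$ that keeps the relations of $P$ and of $Q$ and adds $x\le y$ for all $x\in P$, $y\in Q$. *)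

theory Defs
  imports Complex_Main "HOL-Library.FuncSet"
begin

text \<open>A poset is a carrier set \<open>A\<close> with a relation \<open>r\<close> such that \<^term>\<open>partial_order_on A r\<close>.\<close>

text \<open>Extensional functions, so that maps are counted by their values on \<open>A\<close> only.\<close>

definition order_preserving_maps :: "'a set \<Rightarrow> 'a rel \<Rightarrow> nat \<Rightarrow> ('a \<Rightarrow> nat) set" where
  "order_preserving_maps A r m =
     {f \<in> A \<rightarrow>\<^sub>E {1..m}. monotone_on A (\<lambda>x y. (x, y) \<in> r) (\<le>) f}"

definition order_poly :: "'a set \<Rightarrow> 'a rel \<Rightarrow> nat \<Rightarrow> nat" where
  "order_poly A r m = card (order_preserving_maps A r m)"

text \<open>The carrier of the ordinal sum is the disjoint union \<^term>\<open>A <+> B\<close>.\<close>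

definition ordinal_sum :: "'a set \<Rightarrow> 'a rel \<Rightarrow> 'b set \<Rightarrow> 'b rel \<Rightarrow> ('a + 'b) rel" where
  "ordinal_sum A r B s =
     map_prod Inl Inl ` r \<union> map_prod Inr Inr ` s \<union> (Inl ` A) \<times> (Inr ` B)"

lemma partial_order_on_ordinal_sum:
  assumes "partial_order_on A r" "partial_order_on B s"
  shows "partial_order_on (A <+> B) (ordinal_sum A r B s)"
proof -
  have "r \<subseteq> A \<times> A" "s \<subseteq> B \<times> B" "refl_on A r" "refl_on B s" "trans r" "trans s" "antisym r" "antisym s"
    using assms by (auto simp: partial_order_on_def preorder_on_def)
  then show ?thesis
    unfolding partial_order_on_def preorder_on_def
  proof (intro conjI)
    show "trans (ordinal_sum A r B s)"
      using \<open>r \<subseteq> A \<times> A\<close> \<open>s \<subseteq> B \<times> B\<close> \<open>trans r\<close> \<open>trans s\<close>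
      by (intro transI) (auto simp: ordinal_sum_def dest: transD)
    show "antisym (ordinal_sum A r B s)"
      using \<open>antisym r\<close> \<open>antisym s\<close>
      by (intro antisymI) (auto simp: ordinal_sum_def dest: antisymD)
  qed (auto simp: ordinal_sum_def refl_on_def)
qed

end

theory Submission
  imports Defs
begin

text \<open>
  An order-preserving map on the ordinal sum of \<open>A\<close> and \<open>B\<close> is an order-preserving map \<open>f\<close> on
  \<open>A\<close> together with an order-preserving map on \<open>B\<close> none of whose values lies below
  \<^term>\<open>Max (f ` A)\<close>. Sorting by \<^term>\<open>Max (f ` A) = Suc u\<close> and shifting the map on \<open>B\<close> down by \<open>u\<close>
  turns the count into the convolution (lemma \<open>order_poly_ordinal_sum\<close>)
  \<open>F\<^sub>P(m) = (\<Sum>u<m. (F\<^sub>A(u + 1) - F\<^sub>A(u)) * F\<^sub>B(m - u))\<close>, where \<open>P\<close> is the ordinal sum.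

  The chain basis is adapted to this operation: the difference of its \<open>i\<close>-th member is the number
  of chain maps with a prescribed top value, and convolving that with the \<open>j\<close>-th member gives the
  \<open>(i + j)\<close>-th member (lemma \<open>chain_basis_convolution\<close>). Combinatorially, a chain of length
  \<open>i + j\<close> is the ordinal sum of chains of lengths \<open>i\<close> and \<open>j\<close>. As the convolution is bilinear,
  coefficients in the chain basis multiply like those of ordinary polynomials.
\<close>

section \<open>Counting order-preserving maps on an ordinal sum\<close>

lemma finite_order_preserving_maps:
  assumes "finite A"
  shows "finite (order_preserving_maps A r m)"
  unfolding order_preserving_maps_def
  by (rule finite_subset[of _ "A \<rightarrow>\<^sub>E {1..m}"]) (auto intro: finite_PiE assms)

lemma order_preserving_maps_mono:
  assumes "m \<le> n"
  shows "order_preserving_maps A r m \<subseteq> order_preserving_maps A r n"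
  using assms by (force simp: order_preserving_maps_def PiE_iff)

lemma monotone_on_ordinal_sum_iff:
  "monotone_on (A <+> B) (\<lambda>x y. (x, y) \<in> ordinal_sum A r B s) (\<le>) h \<longleftrightarrow>
     monotone_on A (\<lambda>x y. (x, y) \<in> r) (\<le>) (h \<circ> Inl) \<and>
     monotone_on B (\<lambda>x y. (x, y) \<in> s) (\<le>) (h \<circ> Inr) \<and>
     (\<forall>x\<in>A. \<forall>y\<in>B. h (Inl x) \<le> h (Inr y))"
proof -
  have "(Inl x, Inl x') \<in> ordinal_sum A r B s \<longleftrightarrow> (x, x') \<in> r"
    "(Inr y, Inr y') \<in> ordinal_sum A r B s \<longleftrightarrow> (y, y') \<in> s"
    "(Inl x, Inr y) \<in> ordinal_sum A r B s \<longleftrightarrow> x \<in> A \<and> y \<in> B"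
    "(Inr y, Inl x) \<notin> ordinal_sum A r B s" for x x' y y'
    by (auto simp: ordinal_sum_def)
  then show ?thesis
    by (auto simp: monotone_on_def Plus_def)
qed

text \<open>
  The maps with values in \<open>{1..Suc u}\<close> that do not already have values in \<open>{1..u}\<close> are those with
  maximum exactly \<^term>\<open>Suc u\<close>. This is where \<^term>\<open>A \<noteq> {}\<close> is needed: the map on the empty set has
  no maximum.
\<close>

lemma order_preserving_maps_Suc_diff:
  assumes "finite A" "A \<noteq> {}"
  shows "order_preserving_maps A r (Suc u) - order_preserving_maps A r u =
    {f \<in> A \<rightarrow>\<^sub>E {1..}. monotone_on A (\<lambda>x y. (x, y) \<in> r) (\<le>) f \<and> Max (f ` A) = Suc u}"
proof -
  have "f \<in> A \<rightarrow>\<^sub>E {1..n} \<longleftrightarrow> f \<in> A \<rightarrow>\<^sub>E {1..} \<and> Max (f ` A) \<le> n" for f :: "'a \<Rightarrow> nat" and n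
    using assms by (auto simp: PiE_iff)
  then show ?thesis
    by (auto simp: order_preserving_maps_def)
qed

text \<open>
  The map \<open>g\<close> on the upper summand enters shifted by \<open>u\<close>, so that the maps with values in
  \<open>{u + 1..m}\<close> are represented by the order-preserving maps into \<open>{1..m - u}\<close> and their number
  is again a value of the order polynomial.
\<close>

definition glue :: "'a set \<Rightarrow> 'b set \<Rightarrow> nat \<times> ('a \<Rightarrow> nat) \<times> ('b \<Rightarrow> nat) \<Rightarrow> 'a + 'b \<Rightarrow> nat" where
  "glue A B = (\<lambda>(u, f, g). restrict (case_sum f (\<lambda>y. g y + u)) (A <+> B))"

lemma glue_simps [simp]:
  "x \<in> A \<Longrightarrow> glue A B (u, f, g) (Inl x) = f x"
  "y \<in> B \<Longrightarrow> glue A B (u, f, g) (Inr y) = g y + u"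
  "z \<notin> A <+> B \<Longrightarrow> glue A B (u, f, g) z = undefined"
  by (auto simp: glue_def)

text \<open>
  Every order-preserving map on the ordinal sum is glued in exactly one way, because \<open>u\<close> can be
  read off from the maximum on \<open>A\<close>.
\<close>

lemma bij_betw_glue:
  assumes "finite A" "A \<noteq> {}"
  shows "bij_betw (glue A B)
    (SIGMA u:{..<m}. (order_preserving_maps A r (Suc u) - order_preserving_maps A r u) \<times>
       order_preserving_maps B s (m - u))
    (order_preserving_maps (A <+> B) (ordinal_sum A r B s) m)"
    (is "bij_betw _ ?S ?T")
proof (rule bij_betw_imageI)
  show "inj_on (glue A B) ?S"
  proof (rule inj_onI)
    fix p q assume p: "p \<in> ?S" and q: "q \<in> ?S" and eq: "glue A B p = glue A B q"
    obtain u f g where p_eq: "p = (u, f, g)" by (cases p)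
    obtain v f' g' where q_eq: "q = (v, f', g')" by (cases q)
    have ext: "f \<in> extensional A" "f' \<in> extensional A" "g \<in> extensional B" "g' \<in> extensional B"
      using p q by (auto simp: p_eq q_eq order_preserving_maps_def PiE_def)
    have "f x = f' x" if "x \<in> A" for x
      using fun_cong[OF eq, of "Inl x"] that by (simp add: p_eq q_eq)
    with ext have f: "f = f'" by (intro extensionalityI[of f A f'])
    have "Max (f ` A) = Suc u" "Max (f' ` A) = Suc v"
      using p q by (simp_all add: p_eq q_eq order_preserving_maps_Suc_diff[OF assms])
    with f have u: "u = v" by simp
    have "g y = g' y" if "y \<in> B" for y
      using fun_cong[OF eq, of "Inr y"] that by (simp add: p_eq q_eq u)
    with ext have "g = g'" by (intro extensionalityI[of g B g'])
    with f u show "p = q" by (simp add: p_eq q_eq)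
  qed
  show "glue A B ` ?S = ?T"
  proof
    show "glue A B ` ?S \<subseteq> ?T"
    proof clarify
      fix u f g
      assume u: "u < m" and f: "f \<in> order_preserving_maps A r (Suc u)"
        and g: "g \<in> order_preserving_maps B s (m - u)"
      have fle: "1 \<le> f x" "f x \<le> Suc u" if "x \<in> A" for x
        using f that by (auto simp: order_preserving_maps_def)
      have gle: "1 \<le> g y" "g y \<le> m - u" if "y \<in> B" for y
        using g that by (auto simp: order_preserving_maps_def)
      have "f x \<le> m" if "x \<in> A" for x
        using fle[OF that] u by linarith
      moreover have "g y + u \<le> m" if "y \<in> B" for y
        using gle[OF that] u by linarith
      ultimately have "glue A B (u, f, g) \<in> A <+> B \<rightarrow>\<^sub>E {1..m}"
        using fle(1) gle(1) by (intro PiE_I) (auto elim!: PlusE simp: trans_le_add1)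
      moreover have "f x \<le> g y + u" if "x \<in> A" "y \<in> B" for x y
        using fle(2)[OF that(1)] gle(1)[OF that(2)] by linarith
      moreover have "monotone_on A (\<lambda>x y. (x, y) \<in> r) (\<le>) f" "monotone_on B (\<lambda>x y. (x, y) \<in> s) (\<le>) g"
        using f g by (auto simp: order_preserving_maps_def)
      ultimately show "glue A B (u, f, g) \<in> ?T"
        unfolding order_preserving_maps_def monotone_on_ordinal_sum_iff
        by (simp add: monotone_on_def)
    qed
    show "?T \<subseteq> glue A B ` ?S"
    proof
      fix h assume h: "h \<in> ?T"
      define u where "u = Max ((h \<circ> Inl) ` A) - 1"
      define f where "f = restrict (h \<circ> Inl) A"
      define g where "g = restrict (\<lambda>y. h (Inr y) - u) B"
      have le: "h (Inl x) \<le> h (Inr y)" if "x \<in> A" "y \<in> B" for x y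
        using h that by (auto simp: order_preserving_maps_def monotone_on_ordinal_sum_iff)
      have monoA: "monotone_on A (\<lambda>x y. (x, y) \<in> r) (\<le>) (h \<circ> Inl)"
        and monoB: "monotone_on B (\<lambda>x y. (x, y) \<in> s) (\<le>) (h \<circ> Inr)"
        using h by (auto simp: order_preserving_maps_def monotone_on_ordinal_sum_iff)
      have hA: "1 \<le> h (Inl x)" "h (Inl x) \<le> m" if "x \<in> A" for x
        using h that by (auto simp: order_preserving_maps_def)
      have hB: "h (Inr y) \<le> m" if "y \<in> B" for y
        using h that by (auto simp: order_preserving_maps_def)
      have "Max ((h \<circ> Inl) ` A) \<in> (h \<circ> Inl) ` A"
        using assms by (intro Max_in) auto
      then obtain x0 where x0: "x0 \<in> A" "Max ((h \<circ> Inl) ` A) = h (Inl x0)" by auto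
      have max: "Max ((h \<circ> Inl) ` A) = Suc u"
        using hA(1)[OF x0(1)] unfolding u_def x0(2) by simp
      have u: "u < m"
        using hA(2)[OF x0(1)] max x0(2) by linarith
      have hBu: "Suc u \<le> h (Inr y)" if "y \<in> B" for y
        using le[OF x0(1) that] max x0(2) by simp
      have "f \<in> order_preserving_maps A r (Suc u) - order_preserving_maps A r u"
        using max monoA hA(1) by (auto simp: order_preserving_maps_Suc_diff[OF assms] f_def monotone_on_def)
      moreover have "g \<in> order_preserving_maps B s (m - u)"
        using monoB hB hBu
        by (auto simp: order_preserving_maps_def g_def monotone_on_def Suc_le_eq intro!: diff_le_mono)
      moreover have "h = glue A B (u, f, g)"
      proof
        fix z show "h z = glue A B (u, f, g) z"
        proof (cases "z \<in> A <+> B")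
          case True
          then show ?thesis using hBu by (auto simp: f_def g_def Plus_def Suc_le_eq less_imp_le)
        next
          case False
          then show ?thesis using h by (auto simp: order_preserving_maps_def PiE_def extensional_def)
        qed
      qed
      ultimately show "h \<in> glue A B ` ?S" using u by blast
    qed
  qed
qed

lemma order_poly_ordinal_sum:
  assumes "finite A" "A \<noteq> {}" "finite B"
  shows "order_poly (A <+> B) (ordinal_sum A r B s) m =
    (\<Sum>u<m. (order_poly A r (Suc u) - order_poly A r u) * order_poly B s (m - u))"
proof -
  have "order_poly (A <+> B) (ordinal_sum A r B s) m =
      card (SIGMA u:{..<m}. (order_preserving_maps A r (Suc u) - order_preserving_maps A r u) \<times>
        order_preserving_maps B s (m - u))"
    unfolding order_poly_def by (rule bij_betw_same_card[OF bij_betw_glue[OF assms(1,2)], symmetric])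
  also have "\<dots> = (\<Sum>u<m. (order_poly A r (Suc u) - order_poly A r u) * order_poly B s (m - u))"
    using assms
    by (simp add: finite_order_preserving_maps card_cartesian_product order_poly_def
        card_Diff_subset order_preserving_maps_mono)
  finally show ?thesis .
qed

section \<open>Convolving the chain basis\<close>

text \<open>
  By Pascal's rule, passing from \<open>n\<close> to \<open>n + 1\<close> increases each side of the identity for \<open>j + 1\<close>
  by the same side of the identity for \<open>j\<close> at \<open>n + 1\<close>. Hence the nested induction; for
  \<open>j = 0\<close> the identity is the hockey-stick sum.
\<close>

lemma sum_choose_convolution:
  "(\<Sum>u\<le>n. ((u + p) choose p) * ((n - u + j) choose j)) = (n + p + j + 1) choose (p + j + 1)"
proof (induction j arbitrary: n)
  case 0
  show ?case by (induction n) simp_all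
next
  case (Suc j)
  note lower_j = Suc.IH
  show ?case
  proof (induction n)
    case 0
    show ?case by simp
  next
    case (Suc n)
    let ?c = "\<lambda>u. (u + p) choose p"
    have "(\<Sum>u\<le>Suc n. ?c u * ((Suc n - u + Suc j) choose Suc j)) =
        (\<Sum>u\<le>n. ?c u * ((n - u + Suc j) choose Suc j) + ?c u * ((Suc n - u + j) choose j)) + ?c (Suc n)"
      by (auto intro!: sum.cong simp: Suc_diff_le algebra_simps)
    also have "\<dots> = (\<Sum>u\<le>n. ?c u * ((n - u + Suc j) choose Suc j)) +
        (\<Sum>u\<le>Suc n. ?c u * ((Suc n - u + j) choose j))"
      by (simp add: sum.distrib)
    also have "\<dots> = (n + p + Suc j + 1 choose (p + Suc j + 1)) + (Suc n + p + j + 1 choose (p + j + 1))"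
      by (simp only: Suc.IH lower_j)
    also have "\<dots> = Suc n + p + Suc j + 1 choose (p + Suc j + 1)"
      by simp
    finally show ?case .
  qed
qed

lemma chain_basis_diff:
  assumes "i \<ge> 1"
  shows "((Suc u + i - 1) choose i) = ((u + i - 1) choose i) + ((u + (i - 1)) choose (i - 1))"
  using assms by (cases i) simp_all

text \<open>
  The first factor is the difference of the \<open>i\<close>-th basis member between \<open>u\<close> and \<open>u + 1\<close>, so the
  left-hand side is the convolution of \<open>order_poly_ordinal_sum\<close> for chains of lengths \<open>i\<close> and \<open>j\<close>.
\<close>

lemma chain_basis_convolution:
  assumes "i \<ge> 1"
  shows "(\<Sum>u<m. ((u + (i - 1)) choose (i - 1)) * ((m - u + j - 1) choose j)) =
    ((m + (i + j) - 1) choose (i + j))"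
proof (cases m)
  case 0
  with assms show ?thesis by simp
next
  case (Suc n)
  have "(\<Sum>u<m. ((u + (i - 1)) choose (i - 1)) * ((m - u + j - 1) choose j)) =
      (\<Sum>u\<le>n. ((u + (i - 1)) choose (i - 1)) * ((n - u + j) choose j))"
    by (intro sum.cong) (auto simp: Suc lessThan_Suc_atMost Suc_diff_le)
  also have "\<dots> = (n + (i - 1) + j + 1) choose (i - 1 + j + 1)"
    by (rule sum_choose_convolution)
  finally show ?thesis
    using assms by (simp add: Suc add.assoc)
qed

text \<open>
  Summing over \<^term>\<open>i \<le> k\<close> with \<^term>\<open>j = k - i\<close> visits each pair of indices once, and the pairs
  outside the rectangle contribute nothing. The term \<open>i = k\<close> drops out by \<^term>\<open>b 0 = 0\<close>.
\<close>

lemma sum_Cauchy_product: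
  fixes a b c :: "nat \<Rightarrow> 'c::comm_semiring_1"
  assumes a: "\<And>i. i > M \<Longrightarrow> a i = 0" and b0: "b 0 = 0" and b: "\<And>j. j > N \<Longrightarrow> b j = 0"
  shows "(\<Sum>k=1..M + N. (\<Sum>i=1..k. a i * b (k - i)) * c k) =
    (\<Sum>i=1..M. \<Sum>j=1..N. a i * b j * c (i + j))"
proof -
  have "(\<Sum>k=1..M + N. (\<Sum>i=1..k. a i * b (k - i)) * c k) =
      (\<Sum>(k, i)\<in>(SIGMA k:{1..M + N}. {1..k}). a i * b (k - i) * c k)"
    by (simp add: sum.Sigma sum_distrib_right)
  also have "\<dots> = (\<Sum>(i, j)\<in>{1..M} \<times> {1..N}. a i * b j * c (i + j))"
  proof (rule sum.reindex_bij_witness_not_neutral[symmetric,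
      where S' = "({1..M} \<times> {1..N}) \<inter> {(i, j). a i * b j * c (i + j) = 0}"
        and T' = "(SIGMA k:{1..M + N}. {1..k}) \<inter> {(k, i). a i * b (k - i) * c k = 0}"
        and i = "\<lambda>(k, i). (i, k - i)" and j = "\<lambda>(i, j). (i + j, i)"])
    show "(case p of (k, i) \<Rightarrow> (i, k - i)) \<in>
        {1..M} \<times> {1..N} - {1..M} \<times> {1..N} \<inter> {(i, j). a i * b j * c (i + j) = 0}"
      if p: "p \<in> (SIGMA k:{1..M + N}. {1..k}) -
        (SIGMA k:{1..M + N}. {1..k}) \<inter> {(k, i). a i * b (k - i) * c k = 0}" for p
    proof -
      obtain k i where ki: "p = (k, i)" "i \<ge> 1" "i \<le> k" "a i * b (k - i) * c k \<noteq> 0"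
        using p by auto
      then have "a i \<noteq> 0" "b (k - i) \<noteq> 0" by auto
      then have "i \<le> M" "k - i \<le> N" "k - i \<noteq> 0"
        using a b b0 by (metis not_le)+
      with ki show ?thesis by simp
    qed
  qed auto
  finally show ?thesis by (simp add: sum.cartesian_product)
qed

section \<open>The coefficients of an ordinal sum\<close>

theorem corollary3p5:
  fixes A :: "'a set" and r :: "'a rel"
    and B :: "'b set" and s :: "'b rel"
    and a b :: "nat \<Rightarrow> 'c::field_char_0"
  assumes "finite A" and "A \<noteq> {}" and "partial_order_on A r"
    and "finite B" and "B \<noteq> {}" and "partial_order_on B s"
    and "\<And>m. of_nat (order_poly A r m) = (\<Sum>i=1..card A. a i * of_nat ((m + i - 1) choose i))"
    and "\<And>m. of_nat (order_poly B s m) = (\<Sum>j=1..card B. b j * of_nat ((m + j - 1) choose j))"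
    and "\<And>i. i > card A \<Longrightarrow> a i = 0"
    and "b 0 = 0" and "\<And>j. j > card B \<Longrightarrow> b j = 0"
  shows "of_nat (order_poly (A <+> B) (ordinal_sum A r B s) m) =
    (\<Sum>k=1..card A + card B. (\<Sum>i=1..k. a i * b (k - i)) * of_nat ((m + k - 1) choose k))"
proof -
  let ?c = "\<lambda>i n. of_nat ((n + i - 1) choose i) :: 'c"
  let ?d = "\<lambda>i u. of_nat ((u + (i - 1)) choose (i - 1)) :: 'c"
  have diff: "of_nat (order_poly A r (Suc u) - order_poly A r u) = (\<Sum>i=1..card A. a i * ?d i u)" for u
  proof -
    have "order_poly A r u \<le> order_poly A r (Suc u)"
      unfolding order_poly_def using assms(1)
      by (intro card_mono finite_order_preserving_maps order_preserving_maps_mono) auto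
    then have "of_nat (order_poly A r (Suc u) - order_poly A r u) =
        (\<Sum>i=1..card A. a i * (?c i (Suc u) - ?c i u))"
      by (simp only: of_nat_diff assms(7) sum_subtractf right_diff_distrib)
    also have "\<dots> = (\<Sum>i=1..card A. a i * ?d i u)"
      by (intro sum.cong refl) (simp only: atLeastAtMost_iff chain_basis_diff of_nat_add add_diff_cancel_left')
    finally show ?thesis .
  qed
  have "of_nat (order_poly (A <+> B) (ordinal_sum A r B s) m) =
      (\<Sum>u<m. (\<Sum>i=1..card A. a i * ?d i u) * (\<Sum>j=1..card B. b j * ?c j (m - u)))"
    by (simp only: order_poly_ordinal_sum[OF assms(1,2,4)] of_nat_sum of_nat_mult diff assms(8))
  also have "\<dots> = (\<Sum>u<m. \<Sum>i=1..card A. \<Sum>j=1..card B. a i * b j * (?d i u * ?c j (m - u)))"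
    by (simp only: sum_product mult.assoc mult.left_commute mult.commute)
  also have "\<dots> = (\<Sum>i=1..card A. \<Sum>u<m. \<Sum>j=1..card B. a i * b j * (?d i u * ?c j (m - u)))"
    by (rule sum.swap)
  also have "\<dots> = (\<Sum>i=1..card A. \<Sum>j=1..card B. \<Sum>u<m. a i * b j * (?d i u * ?c j (m - u)))"
    by (intro sum.cong refl sum.swap)
  also have "\<dots> = (\<Sum>i=1..card A. \<Sum>j=1..card B. a i * b j * ?c (i + j) m)"
  proof (intro sum.cong refl)
    fix i j assume "i \<in> {1..card A}"
    then have "i \<ge> 1" by simp
    from chain_basis_convolution[OF this, of m j]
    show "(\<Sum>u<m. a i * b j * (?d i u * ?c j (m - u))) = a i * b j * ?c (i + j) m"
      by (simp flip: sum_distrib_left of_nat_mult of_nat_sum)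
  qed
  also have "\<dots> = (\<Sum>k=1..card A + card B. (\<Sum>i=1..k. a i * b (k - i)) * ?c k m)"
    by (rule sum_Cauchy_product[symmetric]) (use assms(9-11) in auto)
  finally show ?thesis .
qed

end
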